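(* There exists a (sufficiently small) absolute constant $c>0$ such that the following holds. Let $8\le d\le n$, $\varepsilon\in(0,1)$ and let $k\ge2$ be an integer. Assume that $$\varepsilon^2\ge\frac{\max\{8,\ln d\}}{d}\quad\text{and}\quad k\le\frac{c\varepsilon n}{d}.$$ Let $I\subset[n]$ be of cardinality at most $n/8$. Define $$\Gamma_k=\{G\in\mathcal{D}\,:\,\exists S\subseteq I^c,\ |S|=k,\ \text{such that } |\mathcal{N}^{in}_G(S)|\le(1-\varepsilon)d|S|\}$$ and $$\Gamma=\{G\in\mathcal{D}\,:\,\exists S\subseteq I^c,\ S\neq\emptyset,\ |S|\le c\varepsilon n/d,\ \text{such that } |\mathcal{N}^{in}_G(S)|\le(1-\varepsilon)d|S|\}=\bigcup_{2\le\ell\le c\varepsilon n/d}\Gamma_\ell.$$ Then for every $F\subset[n]\times[n]$ with $\mathcal{D}(I,F)\ne\emptyset$ we have $$\mathbb{P}(\Gamma_k\mid\mathcal{D}(I,F))\le\exp\left(-\frac{\varepsilon^2dk}{8}\ln\left(\frac{3ec\varepsilon n}{kd}\right)\right).$$ In particular, $$\mathbb{P}(\Gamma\mid\mathcal{D}(I,F))\le\exp\left(-\frac{\varepsilon^2d}{8}\ln\left(\frac{ec\varepsilon n}{d}\right)\right).$$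
   Context: $[n]=\{1,\dots,n\}$; $n,d$ are positive integers; $I^c=[n]\setminus I$. $\mathcal{D}=\mathcal{D}_{n,d}$ is the set of all $d$-regular directed graphs on the labeled vertex set $[n]$: every vertex has exactly $d$ in-neighbors and $d$ out-neighbors; loops and anti-parallel edges are allowed, multiple edges are not. $\mathbb{P}$ is the normalized counting measure on $\mathcal{D}$. An edge from $i$ to $j$ is written $(i,j)$. $\mathcal{N}^{in}_G(S)=\{v\in[n]:\exists j\in S,\ (v,j)\text{ is an edge of }G\}$. For $S\subset[n]$ and $F\subset[n]\times[n]$, $\mathcal{D}(S,F)$ is the set of all $G\in\mathcal{D}$ such that the set of edges of $G$ ending at a vertex of $S$ is exactly $F$. Here $e$ in the formulas is the base of the natural logarithm. Absolute constants are independent of all parameters. *)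

theory Defs
  imports "HOL-Probability.Probability" "Graph_Theory.Pair_Digraph"
begin

text \<open>
  A digraph with loops and anti-parallel edges but without multiple edges is a
  \<open>pair_pre_digraph\<close>: its edges form a set of pairs, the pair \<open>(i, j)\<close> being the edge
  from \<open>i\<close> to \<open>j\<close>. The vertex set \<open>[n]\<close> is \<open>{1..n}\<close>.
\<close>

definition in_nbrs :: "nat pair_pre_digraph \<Rightarrow> nat set \<Rightarrow> nat set" where
  "in_nbrs G S = {v \<in> pverts G. \<exists>j\<in>S. (v, j) \<in> parcs G}"

definition out_nbrs :: "nat pair_pre_digraph \<Rightarrow> nat set \<Rightarrow> nat set" where
  "out_nbrs G S = {v \<in> pverts G. \<exists>i\<in>S. (i, v) \<in> parcs G}"

definition reg_digraphs :: "nat \<Rightarrow> nat \<Rightarrow> nat pair_pre_digraph set" where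
  "reg_digraphs n d = {G. pair_wf_digraph G \<and> pverts G = {1..n} \<and>
     (\<forall>v\<in>{1..n}. card (in_nbrs G {v}) = d \<and> card (out_nbrs G {v}) = d)}"

definition reg_digraphs_with :: "nat \<Rightarrow> nat \<Rightarrow> nat set \<Rightarrow> (nat \<times> nat) set \<Rightarrow> nat pair_pre_digraph set"
  where "reg_digraphs_with n d S F = {G \<in> reg_digraphs n d. {e \<in> parcs G. snd e \<in> S} = F}"

definition Gamma_k ::
  "nat \<Rightarrow> nat \<Rightarrow> real \<Rightarrow> nat set \<Rightarrow> nat \<Rightarrow> nat pair_pre_digraph set" where
  "Gamma_k n d \<epsilon> I k = {G \<in> reg_digraphs n d. \<exists>S \<subseteq> {1..n} - I. card S = k \<and>
     real (card (in_nbrs G S)) \<le> (1 - \<epsilon>) * real d * real (card S)}"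

definition Gamma_le ::
  "real \<Rightarrow> nat \<Rightarrow> nat \<Rightarrow> real \<Rightarrow> nat set \<Rightarrow> nat pair_pre_digraph set" where
  "Gamma_le c n d \<epsilon> I = {G \<in> reg_digraphs n d. \<exists>S \<subseteq> {1..n} - I. S \<noteq> {} \<and>
     real (card S) \<le> c * \<epsilon> * real n / real d \<and>
     real (card (in_nbrs G S)) \<le> (1 - \<epsilon>) * real d * real (card S)}"

text \<open>
  \<open>cond_prob_reg n d A B\<close> is the probability of \<open>A\<close> given \<open>B\<close> under the normalized
  counting measure on \<open>reg_digraphs n d\<close>.
\<close>

definition cond_prob_reg ::
  "nat \<Rightarrow> nat \<Rightarrow> nat pair_pre_digraph set \<Rightarrow> nat pair_pre_digraph set \<Rightarrow> real" where
  "cond_prob_reg n d A B =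
     \<P>(G in uniform_count_measure (reg_digraphs n d). G \<in> A \<bar> G \<in> B)"

end

theory Submission
  imports Defs
begin

text \<open>
  Replacing edges \<open>(v, j)\<close>, \<open>(u, w)\<close> by \<open>(u, j)\<close>, \<open>(v, w)\<close> keeps a digraph regular, and it does not
  touch the edges into \<open>I\<close> if \<open>j\<close> and \<open>w\<close> lie outside \<open>I\<close>. Counting these switchings in both
  directions (at least \<open>d n / 2\<close> choices of \<open>(u, w)\<close> one way, at most \<open>d\<^sup>2\<close> the other way) shows that
  prescribing one more edge into the complement of \<open>I\<close> costs a factor \<open>2 d / n\<close>, so a
  small set \<open>A\<close> of such edges is present with conditional probability at most \<open>(2 d / n) ^ card A\<close>.

  If \<open>S\<close> has \<open>k\<close> elements and at most \<open>(1 - \<epsilon>) d k\<close> in-neighbours, then the \<open>d k\<close> edges into \<open>S\<close> have at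
  least \<open>\<epsilon> d k\<close> coincidences among their tails. Hence, for \<open>m = \<lfloor>\<epsilon> d k / 2\<rfloor>\<close>, some \<open>m\<close> vertices send
  at least \<open>2 m\<close> edges into \<open>S\<close>. A union bound over \<open>S\<close>, these \<open>m\<close> vertices and the \<open>2 m\<close> edges gives
  \<open>(n choose k) (n choose m) (m k choose 2 m) (2 d / n) ^ (2 m)\<close>. With \<open>x = \<epsilon> n / (d k)\<close> the last three
  factors are at most \<open>(e\<^sup>4 / x) ^ m\<close>, and the assumptions on \<open>\<epsilon>\<close> make the first one negligible
  against this once \<open>x\<close> exceeds an absolute constant.
\<close>

section \<open>Switchings in regular relations\<close>

text \<open>With the vertex set fixed, a digraph is its edge set. In this form reversing all edges
  is \<open>converse\<close>, which turns facts about out-degrees into facts about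
  in-degrees.\<close>

definition reg_rels :: "'a set \<Rightarrow> nat \<Rightarrow> ('a \<times> 'a) set set" where
  "reg_rels V d = {E. E \<subseteq> V \<times> V \<and> (\<forall>v\<in>V. card (E\<inverse> `` {v}) = d \<and> card (E `` {v}) = d)}"

definition reg_rels_with :: "'a set \<Rightarrow> nat \<Rightarrow> 'a set \<Rightarrow> ('a \<times> 'a) set \<Rightarrow> ('a \<times> 'a) set set" where
  "reg_rels_with V d I F = {E \<in> reg_rels V d. {e \<in> E. snd e \<in> I} = F}"

lemma finite_reg_rels: "finite V \<Longrightarrow> finite (reg_rels V d)"
  by (rule finite_subset[of _ "Pow (V \<times> V)"]) (auto simp: reg_rels_def)

lemma finite_reg_rels_with: "finite V \<Longrightarrow> finite (reg_rels_with V d I F)"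
  by (rule finite_subset[OF _ finite_reg_rels[of V d]]) (auto simp: reg_rels_with_def)

lemma finite_arcs_reg_rels: "finite V \<Longrightarrow> E \<in> reg_rels V d \<Longrightarrow> finite E"
  by (rule finite_subset[of _ "V \<times> V"]) (auto simp: reg_rels_def)

lemma converse_reg_rels: "E \<in> reg_rels V d \<Longrightarrow> E\<inverse> \<in> reg_rels V d"
  by (auto simp: reg_rels_def)

lemma card_arcs_from:
  assumes "finite V" "E \<in> reg_rels V d" "S \<subseteq> V"
  shows "card {e \<in> E. fst e \<in> S} = d * card S"
proof -
  have fin: "finite S" "finite E"
    using finite_arcs_reg_rels[OF assms(1,2)] finite_subset[OF assms(3,1)] by auto
  have "{e \<in> E. fst e \<in> S} = (SIGMA v:S. E `` {v})"
    by auto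
  then have "card {e \<in> E. fst e \<in> S} = (\<Sum>v\<in>S. card (E `` {v}))"
    using fin by (simp add: finite_Image)
  also have "\<dots> = (\<Sum>v\<in>S. d)"
    using assms by (intro sum.cong) (auto simp: reg_rels_def)
  finally show ?thesis by simp
qed

lemma card_arcs_into:
  assumes "finite V" "E \<in> reg_rels V d" "S \<subseteq> V"
  shows "card {e \<in> E. snd e \<in> S} = d * card S"
proof -
  have "{e \<in> E\<inverse>. fst e \<in> S} = prod.swap ` {e \<in> E. snd e \<in> S}"
    by force
  then have "card {e \<in> E\<inverse>. fst e \<in> S} = card {e \<in> E. snd e \<in> S}"
    by (simp add: card_image)
  then show ?thesis
    using card_arcs_from[OF assms(1) converse_reg_rels[OF assms(2)] assms(3)] by simp
qed

text \<open>Exchanging the arguments \<open>j\<close> and \<open>w\<close> gives the reverse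
  operation, which restores \<open>E\<close> if both old edges were in \<open>E\<close> and both new
  ones were not.\<close>

definition switch :: "'a \<Rightarrow> 'a \<Rightarrow> 'a \<Rightarrow> 'a \<Rightarrow> ('a \<times> 'a) set \<Rightarrow> ('a \<times> 'a) set" where
  "switch v j u w E = insert (u, j) (insert (v, w) (E - {(v, j), (u, w)}))"

lemma card_insert_remove_eq:
  assumes "finite A" "a \<in> A" "b \<notin> A"
  shows "card (insert b (A - {a})) = card A"
  using assms card.remove[of A a] by simp

lemma converse_switch: "(switch v j u w E)\<inverse> = switch w u j v (E\<inverse>)"
  by (auto simp: switch_def)

text \<open>The row of \<open>v\<close> trades \<open>j\<close> for \<open>w\<close>, the row of
  \<open>u\<close> trades \<open>w\<close> for \<open>j\<close>, and all other rows stay. Absence of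
  the new edges forces \<open>u\<close> and \<open>v\<close>, and likewise \<open>j\<close> and
  \<open>w\<close>, to be distinct.\<close>

lemma out_degree_switch:
  assumes "finite E" "(v, j) \<in> E" "(u, w) \<in> E" "(u, j) \<notin> E" "(v, w) \<notin> E"
  shows "card (switch v j u w E `` {z}) = card (E `` {z})"
proof -
  have uv: "u \<noteq> v" and wj: "w \<noteq> j" using assms by auto
  have fin: "finite (E `` {z})" using assms(1) by (rule finite_Image)
  consider "z = v" | "z = u" | "z \<noteq> v" "z \<noteq> u" by blast
  then show ?thesis
  proof cases
    case 1
    then have "switch v j u w E `` {z} = insert w (E `` {z} - {j})"
      using uv by (auto simp: switch_def)
    then show ?thesis using 1 assms fin card_insert_remove_eq[of "E `` {z}" j w] by simp
  next
    case 2
    then have "switch v j u w E `` {z} = insert j (E `` {z} - {w})"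
      using uv by (auto simp: switch_def)
    then show ?thesis using 2 assms fin card_insert_remove_eq[of "E `` {z}" w j] by simp
  next
    case 3
    then have "switch v j u w E `` {z} = E `` {z}" by (auto simp: switch_def)
    then show ?thesis by simp
  qed
qed

lemma switch_reg_rels:
  assumes "finite V" "E \<in> reg_rels V d"
    and "(v, j) \<in> E" "(u, w) \<in> E" "(u, j) \<notin> E" "(v, w) \<notin> E"
  shows "switch v j u w E \<in> reg_rels V d"
proof -
  have fin: "finite E" using assms finite_arcs_reg_rels by blast
  have "card ((switch v j u w E)\<inverse> `` {z}) = card (E\<inverse> `` {z})" for z
  proof -
    \<comment> \<open>The two removed edges play symmetric roles, so the converse is again a
      switching, of the reversed edges in the original order; in-degrees thus reduce to
      out-degrees.\<close>
    have "switch v j u w E = switch u w v j E"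
      by (auto simp: switch_def)
    then have "(switch v j u w E)\<inverse> = switch j v w u (E\<inverse>)"
      by (simp add: converse_switch)
    then show ?thesis
      using out_degree_switch[of "E\<inverse>" j v w u z] fin assms by simp
  qed
  moreover have "card (switch v j u w E `` {z}) = card (E `` {z})" for z
    using assms(3-6) by (rule out_degree_switch[OF fin])
  moreover have "switch v j u w E \<subseteq> V \<times> V"
    using assms by (auto simp: switch_def reg_rels_def)
  ultimately show ?thesis
    using assms(2) by (auto simp: reg_rels_def)
qed

text \<open>All four edges involved end in \<open>j\<close> or \<open>w\<close>, hence outside
  \<open>I\<close>.\<close>

lemma switch_reg_rels_with:
  assumes "finite V" "E \<in> reg_rels_with V d I F" "j \<notin> I" "w \<notin> I"
    and "(v, j) \<in> E" "(u, w) \<in> E" "(u, j) \<notin> E" "(v, w) \<notin> E"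
  shows "switch v j u w E \<in> reg_rels_with V d I F"
proof -
  have "{e \<in> switch v j u w E. snd e \<in> I} = {e \<in> E. snd e \<in> I}"
    using assms(3,4) by (auto simp: switch_def)
  then show ?thesis
    using assms switch_reg_rels[of V E d v j u w] by (auto simp: reg_rels_with_def)
qed

section \<open>Double counting of switchings\<close>

definition switchable :: "'a set \<Rightarrow> ('a \<times> 'a) set \<Rightarrow> 'a \<Rightarrow> 'a \<Rightarrow> ('a \<times> 'a) set \<Rightarrow> ('a \<times> 'a) set" where
  "switchable I A v j E = {e \<in> E. snd e \<notin> I \<and> (fst e, j) \<notin> E \<and> (v, snd e) \<notin> E} - A"

text \<open>At least \<open>7/8\<close> of all \<open>d * card V\<close> edges end outside
  \<open>I\<close>. Three kinds are lost, each at most a \<open>1/16\<close> fraction: the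
  \<open>d * d\<close> edges leaving in-neighbours of \<open>j\<close>, the \<open>d * d\<close>
  edges entering out-neighbours of \<open>v\<close>, and those in \<open>A\<close>. More than half
  remain.\<close>

lemma card_switchable:
  assumes "finite V" "E \<in> reg_rels V d" "I \<subseteq> V" "finite A" "v \<in> V" "j \<in> V"
    and "8 * card I \<le> card V" "16 * d \<le> card V" "16 * card A \<le> card V" "1 \<le> d"
  shows "d * card V \<le> 2 * card (switchable I A v j E)"
proof -
  let ?W = "switchable I A v j E"
  have fin: "finite E" "finite I"
    using finite_arcs_reg_rels[OF assms(1,2)] finite_subset[OF assms(3,1)] by auto
  have sub: "E\<inverse> `` {j} \<subseteq> V" "E `` {v} \<subseteq> V" "E \<subseteq> V \<times> V"
    using assms(2) by (auto simp: reg_rels_def)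
  have deg: "card (E\<inverse> `` {j}) = d" "card (E `` {v}) = d"
    using assms by (auto simp: reg_rels_def)
  let ?X = "{e \<in> E. fst e \<in> E\<inverse> `` {j}}" and ?Y = "{e \<in> E. snd e \<in> E `` {v}}"
  have "{e \<in> E. snd e \<in> V - I} \<subseteq> ?W \<union> (?X \<union> (?Y \<union> A))"
    unfolding switchable_def by auto
  then have "card {e \<in> E. snd e \<in> V - I} \<le> card (?W \<union> (?X \<union> (?Y \<union> A)))"
    using fin assms(4) by (intro card_mono) (auto simp: switchable_def)
  also have "\<dots> \<le> card ?W + (card ?X + (card ?Y + card A))"
    by (meson add_left_mono card_Un_le order_trans)
  also have "card ?X = d * d" using card_arcs_from[OF assms(1,2) sub(1)] deg by simp
  also have "card ?Y = d * d" using card_arcs_into[OF assms(1,2) sub(2)] deg by simp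
  finally have "d * (card V - card I) \<le> card ?W + 2 * (d * d) + card A"
    using card_arcs_into[OF assms(1,2), of "V - I"] assms(3) fin by (simp add: card_Diff_subset)
  moreover have "d * card V \<le> d * (card V - card I) + d * card I"
    by (metis add_mult_distrib2 le_diff_conv mult_le_mono2 order_refl)
  moreover have "8 * (d * card I) \<le> d * card V" "16 * (d * d) \<le> d * card V"
    using assms(7,8) mult_le_mono2[of "8 * card I" "card V" d] mult_le_mono2[of "16 * d" "card V" d]
    by (simp_all add: mult.left_commute)
  moreover have "16 * card A \<le> d * card V"
    using assms(9,10) by (metis mult_1 mult_le_mono1 order_trans)
  ultimately show ?thesis by linarith
qed

text \<open>Both sides count pairs of a relation and an edge: switching sends the at least
  \<open>d * card V / 2\<close> pairs over each relation containing \<open>insert (v, j) A\<close>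
  injectively to pairs over relations containing \<open>A\<close>, with at most \<open>d * d\<close>
  over each.\<close>

lemma card_supersets_insert:
  assumes "finite V" "I \<subseteq> V" "finite A" "v \<in> V" "j \<in> V - I" "(v, j) \<notin> A"
    and "8 * card I \<le> card V" "16 * d \<le> card V" "16 * card A \<le> card V" "1 \<le> d"
  shows "card {E \<in> reg_rels_with V d I F. insert (v, j) A \<subseteq> E} * card V
    \<le> 2 * d * card {E \<in> reg_rels_with V d I F. A \<subseteq> E}"
proof -
  let ?P = "{E \<in> reg_rels_with V d I F. insert (v, j) A \<subseteq> E}"
  let ?Q = "{E \<in> reg_rels_with V d I F. A \<subseteq> E}"
  have reg: "E \<in> reg_rels V d" if "E \<in> reg_rels_with V d I F" for E
    using that by (simp add: reg_rels_with_def)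
  have finE: "finite E" if "E \<in> reg_rels_with V d I F" for E
    using that reg assms(1) finite_arcs_reg_rels by blast
  have finPQ: "finite ?P" "finite ?Q" using finite_reg_rels_with[OF assms(1)] by auto
  \<comment> \<open>Keeping \<open>(u, w)\<close> next to the switched relation makes the map
    invertible.\<close>
  let ?f = "\<lambda>(E, u, w). (switch v j u w E, u, w)"
  have "inj_on ?f (SIGMA E:?P. switchable I A v j E)"
  proof (rule inj_on_inverseI[where g = "\<lambda>(E, u, w). (switch v w u j E, u, w)"])
    fix x assume "x \<in> (SIGMA E:?P. switchable I A v j E)"
    then obtain E u w where x: "x = (E, u, w)" and "(v, j) \<in> E" "(u, w) \<in> E" "(u, j) \<notin> E" "(v, w) \<notin> E"
      by (auto simp: switchable_def)
    then have "switch v w u j (switch v j u w E) = E" by (auto simp: switch_def)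
    then show "(case ?f x of (E, u, w) \<Rightarrow> (switch v w u j E, u, w)) = x" by (simp add: x)
  qed
  \<comment> \<open>After the switching \<open>(u, j)\<close> and \<open>(v, w)\<close> are edges,
    so \<open>u\<close> is one of \<open>d\<close> in-neighbours of \<open>j\<close> and
    \<open>w\<close> one of \<open>d\<close> out-neighbours of \<open>v\<close>.\<close>
  moreover have "?f ` (SIGMA E:?P. switchable I A v j E) \<subseteq> (SIGMA E:?Q. (E\<inverse> `` {j}) \<times> (E `` {v}))"
  proof
    fix y assume "y \<in> ?f ` (SIGMA E:?P. switchable I A v j E)"
    then obtain E u w where y: "y = (switch v j u w E, u, w)" and E: "E \<in> reg_rels_with V d I F"
      and AE: "insert (v, j) A \<subseteq> E"
      and uw: "(u, w) \<in> E" "(u, j) \<notin> E" "(v, w) \<notin> E" "w \<notin> I" "(u, w) \<notin> A"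
      by (auto simp: switchable_def)
    have "switch v j u w E \<in> reg_rels_with V d I F"
      using switch_reg_rels_with[of V E d I F j w v u] assms E AE uw by auto
    \<comment> \<open>Neither removed edge lies in \<open>A\<close>: \<open>(v, j)\<close> by
      hypothesis, \<open>(u, w)\<close> by the definition of \<open>switchable\<close>.\<close>
    moreover have "A \<subseteq> switch v j u w E"
      using AE uw assms(6) by (auto simp: switch_def)
    ultimately show "y \<in> (SIGMA E:?Q. (E\<inverse> `` {j}) \<times> (E `` {v}))"
      by (auto simp: y switch_def)
  qed
  moreover have "finite (SIGMA E:?Q. (E\<inverse> `` {j}) \<times> (E `` {v}))"
    using finPQ finE by (intro finite_SigmaI) (auto intro: finite_Image)
  ultimately have "card (SIGMA E:?P. switchable I A v j E)
      \<le> card (SIGMA E:?Q. (E\<inverse> `` {j}) \<times> (E `` {v}))"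
    using card_inj_on_le by blast
  also have "card (SIGMA E:?P. switchable I A v j E) = (\<Sum>E\<in>?P. card (switchable I A v j E))"
    using finPQ finE by (intro card_SigmaI) (auto simp: switchable_def)
  also have "card (SIGMA E:?Q. (E\<inverse> `` {j}) \<times> (E `` {v})) = (\<Sum>E\<in>?Q. card ((E\<inverse> `` {j}) \<times> (E `` {v})))"
    using finPQ finE by (intro card_SigmaI) (auto intro: finite_Image)
  also have "(\<Sum>E\<in>?Q. card ((E\<inverse> `` {j}) \<times> (E `` {v}))) = (\<Sum>E\<in>?Q. d * d)"
    using reg assms(4,5) by (intro sum.cong) (auto simp: card_cartesian_product reg_rels_def)
  finally have le: "(\<Sum>E\<in>?P. card (switchable I A v j E)) \<le> card ?Q * (d * d)" by simp
  have "(\<Sum>E\<in>?P. d * card V) \<le> (\<Sum>E\<in>?P. 2 * card (switchable I A v j E))"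
    using assms reg by (intro sum_mono card_switchable) auto
  then have "card ?P * (d * card V) \<le> 2 * (\<Sum>E\<in>?P. card (switchable I A v j E))"
    by (simp add: sum_distrib_left)
  also have "\<dots> \<le> 2 * (card ?Q * (d * d))" using le by simp
  finally have "d * (card ?P * card V) \<le> d * (2 * d * card ?Q)" by (simp add: ac_simps)
  then show ?thesis
    using assms(10) unfolding mult_le_cancel1 by linarith
qed

text \<open>The edges of \<open>A\<close> are prescribed one at a time, each costing one factor from
  \<open>card_supersets_insert\<close>.\<close>

lemma card_supersets_le:
  fixes A :: "('a \<times> 'a) set"
  assumes "finite V" "I \<subseteq> V" "finite A" "A \<subseteq> V \<times> (V - I)"
    and "8 * card I \<le> card V" "16 * d \<le> card V" "16 * card A \<le> card V" "1 \<le> d"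
  shows "real (card {E \<in> reg_rels_with V d I F. A \<subseteq> E})
    \<le> (2 * real d / real (card V)) ^ card A * real (card (reg_rels_with V d I F))"
  using assms(3,4,7)
proof (induction A rule: finite_induct)
  case empty
  then show ?case by simp
next
  case (insert e A)
  obtain v j where e: "e = (v, j)" by (cases e)
  have n: "real (card V) > 0" using assms(6,8) by simp
  have "real (card {E \<in> reg_rels_with V d I F. insert e A \<subseteq> E} * card V)
      \<le> real (2 * d * card {E \<in> reg_rels_with V d I F. A \<subseteq> E})"
    unfolding e using insert assms e
    by (intro of_nat_mono card_supersets_insert) auto
  then have "real (card {E \<in> reg_rels_with V d I F. insert e A \<subseteq> E})
      \<le> (2 * real d / real (card V)) * real (card {E \<in> reg_rels_with V d I F. A \<subseteq> E})"
    using n by (simp add: field_simps)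
  also have "\<dots> \<le> (2 * real d / real (card V)) *
      ((2 * real d / real (card V)) ^ card A * real (card (reg_rels_with V d I F)))"
    using insert by (intro mult_left_mono) auto
  finally show ?case using insert by (simp add: mult.assoc)
qed

text \<open>
  If \<open>fst ` R\<close> has at least \<open>m\<close> elements, choose one element of \<open>R\<close> over each of them, pick \<open>m\<close> of
  the remaining ones, and add the chosen elements over a set of \<open>m\<close> first components covering these.
\<close>

lemma dense_rows:
  fixes R :: "('a \<times> 'b) set"
  assumes "finite V" "finite R" "fst ` R \<subseteq> V" "m \<le> card V"
    and "card (fst ` R) + m \<le> card R" "2 * m \<le> card R"
  obtains T A where "T \<subseteq> V" "card T = m" "A \<subseteq> R" "fst ` A \<subseteq> T" "card A = 2 * m"
proof (cases "card (fst ` R) < m")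
  \<comment> \<open>All first components fit into one set of \<open>m\<close> elements, so any
    \<open>2 * m\<close> elements of \<open>R\<close> will do.\<close>
  case True
  then have "\<exists>T. fst ` R \<subseteq> T \<and> T \<subseteq> V \<and> card T = m"
    using assms(1,3,4) by (intro exists_subset_between) simp_all
  then obtain T where T: "fst ` R \<subseteq> T" "T \<subseteq> V" "card T = m" by blast
  obtain A where "A \<subseteq> R" "card A = 2 * m"
    using obtain_subset_with_card_n[OF assms(6)] by blast
  then show ?thesis using T by (intro that[of T A]) auto
next
  case False
  define a where "a = inv_into R fst"
  have a: "a v \<in> R" "fst (a v) = v" if "v \<in> fst ` R" for v
    using that by (auto simp: a_def inv_into_into f_inv_into_f)
  have inj: "inj_on a (fst ` R)" by (rule inj_onI) (metis a(2))
  have "a ` fst ` R \<subseteq> R"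
    using a(1) by (rule image_subsetI)
  then have "card (R - a ` fst ` R) = card R - card (fst ` R)"
    using assms(2) card_image[OF inj] by (simp add: card_Diff_subset)
  then have "m \<le> card (R - a ` fst ` R)" using assms(5) by simp
  then obtain A where A: "A \<subseteq> R - a ` fst ` R" "card A = m" "finite A"
    using obtain_subset_with_card_n by blast
  have "card (fst ` A) \<le> m" using A card_image_le by blast
  moreover have "fst ` A \<subseteq> fst ` R" using A by auto
  ultimately have "\<exists>T. fst ` A \<subseteq> T \<and> T \<subseteq> fst ` R \<and> card T = m"
    using False assms(2) by (intro exists_subset_between) simp_all
  then obtain T where T: "fst ` A \<subseteq> T" "T \<subseteq> fst ` R" "card T = m" by blast
  have finT: "finite T" using T(2) assms(2) finite_subset by blast
  have aT: "a v \<in> R" "fst (a v) \<in> T" if "v \<in> T" for v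
    using a[OF subsetD[OF T(2) that]] that by simp_all
  have "A \<inter> a ` T = {}" using A(1) T(2) by fast
  then have "card (A \<union> a ` T) = card A + card (a ` T)"
    using A(3) finT by (simp add: card_Un_disjoint)
  also have "card (a ` T) = m" using T inj card_image inj_on_subset by metis
  finally have "card (A \<union> a ` T) = 2 * m" using A by simp
  moreover have "A \<union> a ` T \<subseteq> R" using A(1) aT(1) by blast
  moreover have "fst ` (A \<union> a ` T) \<subseteq> T" using T(1) aT(2) by blast
  moreover have "T \<subseteq> V" using T assms(3) by auto
  ultimately show ?thesis using T by (intro that[of T "A \<union> a ` T"]) auto
qed

section \<open>Estimates for the union bound\<close>

text \<open>The term of index \<open>k\<close> in the series of \<open>exp k\<close> gives
  \<open>k ^ k / fact k \<le> exp k\<close>, and \<open>(n choose k) * fact k \<le> n ^ k\<close>.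
  For \<open>k = 0\<close> both sides are \<open>1\<close>.\<close>

lemma binomial_le_exp_power:
  "real (n choose k) \<le> (exp 1 * real n / real k) ^ k"
proof (cases "k = 0")
  case False
  have "(\<lambda>i. real k ^ i /\<^sub>R fact i) sums exp (real k)" by (rule exp_converges)
  then have "real k ^ k /\<^sub>R fact k \<le> exp (real k)"
    using sum_le_suminf[of "\<lambda>i. real k ^ i /\<^sub>R fact i" "{k}"] by (simp add: sums_iff)
  then have k: "real k ^ k \<le> exp 1 ^ k * fact k"
    by (simp add: field_simps flip: exp_of_nat_mult)
  have "real (n choose k) * real k ^ k \<le> real (n choose k) * (exp 1 ^ k * fact k)"
    using k by (intro mult_left_mono) auto
  also have "\<dots> = exp 1 ^ k * real ((n choose k) * fact k)" by simp
  also have "\<dots> \<le> exp 1 ^ k * real (n ^ k)"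
    using binomial_fact_pow[of n k] by (intro mult_left_mono of_nat_mono) auto
  finally show ?thesis
    using False by (simp add: power_divide power_mult_distrib field_simps)
qed simp

text \<open>Choosing \<open>S\<close> costs at most
  \<open>exp (y / 8 + y * ln x / 8 + 2 * y)\<close>, while the other factors gain
  \<open>exp (7 / 16 * y * (4 - ln x))\<close>. The gain wins once \<open>ln x\<close> is at least
  \<open>26\<close>.\<close>

lemma union_bound_estimate:
  fixes \<epsilon> :: real and n d k m :: nat
  defines "y \<equiv> \<epsilon> * real d * real k" and "x \<equiv> \<epsilon> * real n / (real d * real k)"
  assumes \<epsilon>: "0 < \<epsilon>" "\<epsilon> < 1" and d: "8 \<le> d" and k: "2 \<le> k"
    and \<epsilon>8: "8 \<le> \<epsilon>\<^sup>2 * real d" and \<epsilon>ln: "ln (real d) \<le> \<epsilon>\<^sup>2 * real d"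
    and x: "exp 26 \<le> x" and m: "y / 2 - 1 \<le> real m"
  shows "real (n choose k) * real (n choose m) * real ((m * k) choose (2 * m))
      * (2 * real d / real n) ^ (2 * m) \<le> exp (- y * (1 + ln x / 8))"
proof -
  have "\<epsilon>\<^sup>2 \<le> \<epsilon>" using \<epsilon> by (simp add: power2_eq_square)
  then have \<epsilon>d: "\<epsilon>\<^sup>2 * real d \<le> \<epsilon> * real d" by (simp add: mult_right_mono)
  have k8: "8 * real k \<le> y"
    unfolding y_def using \<epsilon>8 \<epsilon>d by (intro mult_right_mono) auto
  then have y16: "16 \<le> y" using k by linarith
  have x0: "x > 0" using x by (meson exp_gt_zero less_le_trans)
  then have n0: "real n > 0" by (cases "n = 0") (auto simp: x_def)
  have d0: "real d > 0" and k0: "real k > 0" using d k by auto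
  have lnx: "26 \<le> ln x" using x x0 by (simp add: ln_ge_iff)
  \<comment> \<open>Since \<open>y\<close> is at least \<open>16\<close>, rounding loses at most
    \<open>1 \<le> y / 16\<close>.\<close>
  have m7: "7 / 16 * y \<le> real m" using m y16 by linarith
  then have m0: "real m > 0" using y16 by linarith
  have "(exp 1 * real n / real k) ^ k \<le> exp (y / 8 + y * ln x / 8 + 2 * y)"
  proof -
    \<comment> \<open>Solving the definition of \<open>x\<close> gives
      \<open>n / k = x * d / \<epsilon>\<close>. Both \<open>ln d\<close> and
      \<open>ln (1 / \<epsilon>)\<close> are then bounded by \<open>\<epsilon> * d\<close>, which
      yields the term \<open>2 * y\<close>; the rest is absorbed by
      \<open>k \<le> y / 8\<close>.\<close>
    have "exp 1 * real n / real k = exp (1 + ln x + ln (real d) + ln (1 / \<epsilon>))"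
      using x0 d0 \<epsilon> k0 by (simp add: exp_add) (simp add: x_def field_simps)
    then have "(exp 1 * real n / real k) ^ k = exp (real k * (1 + ln x + ln (real d) + ln (1 / \<epsilon>)))"
      by (simp only: exp_of_nat_mult)
    moreover have "ln (1 / \<epsilon>) \<le> ln (real d)"
    proof (subst ln_le_cancel_iff)
      have "1 \<le> \<epsilon> * real d" using \<epsilon>8 \<epsilon>d by linarith
      then show "1 / \<epsilon> \<le> real d" using \<epsilon> by (simp add: divide_le_eq mult.commute)
    qed (use \<epsilon> d0 in auto)
    moreover have "ln (real d) \<le> \<epsilon> * real d" using \<epsilon>ln \<epsilon>d by linarith
    ultimately have "(exp 1 * real n / real k) ^ k \<le> exp (real k * (1 + ln x + 2 * (\<epsilon> * real d)))"
      using k0 by (simp add: mult_left_mono)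
    also have "real k * (1 + ln x + 2 * (\<epsilon> * real d)) = real k * (1 + ln x) + 2 * y"
      by (simp add: y_def algebra_simps)
    also have "exp (real k * (1 + ln x) + 2 * y) \<le> exp (y / 8 * (1 + ln x) + 2 * y)"
      using mult_right_mono[of "real k" "y / 8" "1 + ln x"] k8 lnx by simp
    also have "y / 8 * (1 + ln x) + 2 * y = y / 8 + y * ln x / 8 + 2 * y"
      by (simp add: field_simps)
    finally show ?thesis .
  qed
  then have A: "real (n choose k) \<le> exp (y / 8 + y * ln x / 8 + 2 * y)"
    using binomial_le_exp_power order_trans by blast
  have "real (n choose m) * real ((m * k) choose (2 * m)) * (2 * real d / real n) ^ (2 * m)
      \<le> (exp 1 * real n / real m) ^ m * (exp 1 * real (m * k) / real (2 * m)) ^ (2 * m)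
        * (2 * real d / real n) ^ (2 * m)"
    by (intro mult_mono binomial_le_exp_power) auto
  also have "\<dots> = (exp 1 * real n / real m * (exp 1 * real (m * k) / real (2 * m))\<^sup>2
        * (2 * real d / real n)\<^sup>2) ^ m"
    by (simp only: power_mult power_mult_distrib)
  \<comment> \<open>The factor \<open>2\<close> in the switching cost cancels against the
    \<open>2 * m\<close> in the binomial bound.\<close>
  also have "exp 1 * real n / real m * (exp 1 * real (m * k) / real (2 * m))\<^sup>2
        * (2 * real d / real n)\<^sup>2 = exp 1 ^ 3 * (real k * real d / real m) * (real k * real d / real n)"
    using n0 m0 by (simp add: field_simps power2_eq_square power3_eq_cube)
  also have "(exp 1 ^ 3 * (real k * real d / real m) * (real k * real d / real n)) ^ m
      \<le> exp (4 - ln x) ^ m"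
  proof (rule power_mono)
    \<comment> \<open>Here \<open>16 / 7 \<le> 5 / 2 \<le> exp 1\<close>; together with
      \<open>exp 1 ^ 3\<close> this gives \<open>exp 4\<close>, and
      \<open>k * d / (\<epsilon> * n)\<close> is \<open>1 / x\<close>.\<close>
    have "real k * real d / real m \<le> 16 / 7 / \<epsilon>"
      using m7 m0 \<epsilon> by (simp add: y_def field_simps)
    also have "\<dots> \<le> exp 1 / \<epsilon>"
      using exp_lower_Taylor_quadratic[of 1] \<epsilon> by (intro divide_right_mono) auto
    finally have "exp 1 ^ 3 * (real k * real d / real m) * (real k * real d / real n)
        \<le> exp 1 ^ 3 * (exp 1 / \<epsilon>) * (real k * real d / real n)"
      by (intro mult_right_mono mult_left_mono) auto
    also have "\<dots> = exp 4 / x"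
      by (simp add: x_def field_simps power3_eq_cube flip: exp_add)
    also have "\<dots> = exp (4 - ln x)" using x0 by (simp add: exp_diff)
    finally show "exp 1 ^ 3 * (real k * real d / real m) * (real k * real d / real n) \<le> exp (4 - ln x)" .
  qed auto
  also have "\<dots> = exp (real m * (4 - ln x))" by (simp add: exp_of_nat_mult)
  \<comment> \<open>The factor \<open>4 - ln x\<close> is negative, so the lower bound on
    \<open>m\<close> gives an upper bound here.\<close>
  also have "\<dots> \<le> exp (7 / 16 * y * (4 - ln x))"
    using m7 lnx by (simp add: mult_right_mono_neg)
  finally have B: "real (n choose m) * real ((m * k) choose (2 * m)) * (2 * real d / real n) ^ (2 * m)
      \<le> exp (7 / 16 * y * (4 - ln x))" .
  have "real (n choose k) * (real (n choose m) * real ((m * k) choose (2 * m)) * (2 * real d / real n) ^ (2 * m))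
      \<le> exp (y / 8 + y * ln x / 8 + 2 * y) * exp (7 / 16 * y * (4 - ln x))"
    using A B by (intro mult_mono) auto
  also have "\<dots> = exp (y * (31 / 8 - 5 / 16 * ln x))"
    by (simp add: field_simps flip: exp_add)
  also have "\<dots> \<le> exp (y * - (1 + ln x / 8))"
  proof -
    \<comment> \<open>This amounts to \<open>39 / 8 \<le> 3 / 16 * ln x\<close>, that is,
      \<open>26 \<le> ln x\<close>: the source of the constant \<open>26\<close>.\<close>
    have "31 / 8 - 5 / 16 * ln x \<le> - (1 + ln x / 8)" using lnx by linarith
    then show ?thesis using y16 by (simp only: exp_le_cancel_iff) (intro mult_left_mono, auto)
  qed
  finally show ?thesis by (simp only: mult.assoc mult_minus_left mult_minus_right)
qed

text \<open>Reduces the bound for \<open>\<Gamma>\<close> to a geometric sum over the sizes \<open>l\<close>.\<close>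

lemma mult_ln_div_ge:
  fixes l a :: real
  assumes "1 \<le> l" "exp 1 * l \<le> a"
  shows "ln a \<le> l * ln (a / l)"
proof -
  have l: "l > 0" and a: "a > 0" using assms less_le_trans[of 0 "exp 1 * l" a] by auto
  have "1 + ln l \<le> ln a"
    using assms l a by (metis exp_gt_zero exp_ln_iff ln_exp ln_le_cancel_iff ln_mult_pos mult_pos_pos)
  \<comment> \<open>The claim is equivalent to \<open>l * ln l \<le> (l - 1) * ln a\<close>, and
    \<open>(l - 1) * (1 + ln l)\<close> lies between the two sides.\<close>
  then have "(l - 1) * (1 + ln l) \<le> (l - 1) * ln a"
    using assms by (intro mult_left_mono) auto
  moreover have "ln l \<le> l - 1" using l by (rule ln_le_minus_one)
  ultimately show ?thesis using l a by (simp add: ln_div algebra_simps)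
qed

text \<open>Comparison with the series of powers of \<open>1/2\<close>; it allows the union over all
  sizes without loss.\<close>

lemma sum_exp_neg_le_1: "(\<Sum>l=2..N::nat. exp (- real l)) \<le> 1"
proof -
  have "(\<Sum>l=2..N. exp (- real l)) \<le> (\<Sum>l=2..N. (1/2) ^ l)"
  proof (rule sum_mono)
    fix l
    have "exp (- real l) = (1 / exp 1) ^ l"
      by (simp add: exp_minus exp_of_nat_mult power_one_over inverse_eq_divide flip: exp_of_nat_mult)
    also have "\<dots> \<le> (1/2) ^ l"
      using exp_ge_add_one_self[of 1] by (intro power_mono) (auto intro!: divide_left_mono)
    finally show "exp (- real l) \<le> (1/2) ^ l" .
  qed
  also have "\<dots> \<le> (\<Sum>l. (1/2::real) ^ Suc l)"
  proof -
    have "(\<Sum>l=2..N. (1/2::real) ^ l) \<le> (\<Sum>l=Suc 0..<Suc N. (1/2) ^ l)"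
      by (intro sum_mono2) auto
    also have "\<dots> = (\<Sum>l=0..<N. (1/2) ^ Suc l)" by (rule sum.shift_bounds_Suc_ivl)
    also have "\<dots> \<le> (\<Sum>l. (1/2::real) ^ Suc l)"
      using power_half_series by (intro sum_le_suminf) (auto simp: sums_iff)
    finally show ?thesis .
  qed
  also have "\<dots> = 1" using power_half_series by (simp add: sums_iff)
  finally show ?thesis .
qed

section \<open>Contracting sets\<close>

text \<open>The counterpart of \<open>Gamma_k\<close> for edge sets, already intersected with the
  conditioning event; the image under \<open>fst\<close> is the in-neighbourhood of
  \<open>S\<close>.\<close>

definition contracting_rels ::
  "'a set \<Rightarrow> nat \<Rightarrow> 'a set \<Rightarrow> ('a \<times> 'a) set \<Rightarrow> real \<Rightarrow> nat \<Rightarrow> ('a \<times> 'a) set set" where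
  "contracting_rels V d I F \<epsilon> k = {E \<in> reg_rels_with V d I F. \<exists>S \<subseteq> V - I. card S = k \<and>
     real (card (fst ` {e \<in> E. snd e \<in> S})) \<le> (1 - \<epsilon>) * real d * real k}"

text \<open>The \<open>d * k\<close> edges into \<open>S\<close> have at most
  \<open>d * k - 2 * m\<close> distinct tails, so \<open>dense_rows\<close> finds \<open>m\<close>
  tails carrying \<open>2 * m\<close> of these edges.\<close>

lemma contracting_rels_subset:
  assumes "finite V" "m \<le> card V" "0 \<le> \<epsilon>" "\<epsilon> \<le> 1" "2 * real m \<le> \<epsilon> * real d * real k"
  shows "contracting_rels V d I F \<epsilon> k \<subseteq>
    (\<Union>S\<in>{S. S \<subseteq> V - I \<and> card S = k}. \<Union>T\<in>{T. T \<subseteq> V \<and> card T = m}.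
      \<Union>A\<in>{A. A \<subseteq> T \<times> S \<and> card A = 2 * m}. {E \<in> reg_rels_with V d I F. A \<subseteq> E})"
proof
  fix E assume "E \<in> contracting_rels V d I F \<epsilon> k"
  then obtain S where E: "E \<in> reg_rels_with V d I F" "E \<in> reg_rels V d"
    and S: "S \<subseteq> V - I" "card S = k"
    and le: "real (card (fst ` {e \<in> E. snd e \<in> S})) \<le> (1 - \<epsilon>) * real d * real k"
    by (auto simp: contracting_rels_def reg_rels_with_def)
  let ?R = "{e \<in> E. snd e \<in> S}"
  have "S \<subseteq> V" using S by auto
  then have card: "card ?R = d * k"
    using card_arcs_into[OF assms(1) E(2)] S by simp
  have "finite ?R" using finite_arcs_reg_rels[OF assms(1) E(2)] by simp
  moreover have "fst ` ?R \<subseteq> V" using E(2) by (auto simp: reg_rels_def)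
  moreover have "real (card (fst ` ?R) + m) \<le> real (d * k)"
    using le assms(5) by (simp add: algebra_simps)
  then have "card (fst ` ?R) + m \<le> card ?R" unfolding card of_nat_le_iff .
  moreover have "\<epsilon> * (real d * real k) \<le> 1 * (real d * real k)"
    using assms(4) by (intro mult_right_mono) auto
  then have "real (2 * m) \<le> real (d * k)" using assms(5) by (simp add: mult.assoc)
  then have "2 * m \<le> card ?R" unfolding card of_nat_le_iff .
  ultimately obtain T A where T: "T \<subseteq> V" "card T = m" and A: "A \<subseteq> ?R" "fst ` A \<subseteq> T" "card A = 2 * m"
    using dense_rows[OF assms(1) _ _ assms(2)] by blast
  have "A \<subseteq> T \<times> S" using A by force
  moreover have "A \<subseteq> E" using A by auto
  ultimately show "E \<in> (\<Union>S\<in>{S. S \<subseteq> V - I \<and> card S = k}. \<Union>T\<in>{T. T \<subseteq> V \<and> card T = m}.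
      \<Union>A\<in>{A. A \<subseteq> T \<times> S \<and> card A = 2 * m}. {E \<in> reg_rels_with V d I F. A \<subseteq> E})"
    using E(1) S T A(3) by blast
qed

lemma card_UN_le_mult:
  assumes "finite J" "card J \<le> N" "\<And>i. i \<in> J \<Longrightarrow> real (card (X i)) \<le> b" "0 \<le> b"
  shows "real (card (\<Union>i\<in>J. X i)) \<le> real N * b"
proof -
  have "real (card (\<Union>i\<in>J. X i)) \<le> real (\<Sum>i\<in>J. card (X i))"
    using card_UN_le[OF assms(1)] by (intro of_nat_mono)
  also have "\<dots> \<le> (\<Sum>i\<in>J. b)" using assms(3) by (simp only: of_nat_sum) (rule sum_mono)
  also have "\<dots> = real (card J) * b" by simp
  also have "\<dots> \<le> real N * b" using assms(2,4) by (intro mult_right_mono) auto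
  finally show ?thesis .
qed

lemma card_contracting_rels_le:
  assumes "finite V" "I \<subseteq> V" "8 * card I \<le> card V" "16 * d \<le> card V" "1 \<le> d"
    and "32 * m \<le> card V" "0 \<le> \<epsilon>" "\<epsilon> \<le> 1" "2 * real m \<le> \<epsilon> * real d * real k"
  shows "real (card (contracting_rels V d I F \<epsilon> k))
    \<le> real (card V choose k) * (real (card V choose m) * (real ((m * k) choose (2 * m))
      * ((2 * real d / real (card V)) ^ (2 * m) * real (card (reg_rels_with V d I F)))))"
proof -
  let ?D = "reg_rels_with V d I F"
  let ?b = "(2 * real d / real (card V)) ^ (2 * m) * real (card ?D)"
  let ?U = "\<Union>S\<in>{S. S \<subseteq> V - I \<and> card S = k}. \<Union>T\<in>{T. T \<subseteq> V \<and> card T = m}.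
      \<Union>A\<in>{A. A \<subseteq> T \<times> S \<and> card A = 2 * m}. {E \<in> ?D. A \<subseteq> E}"
  have "?U \<subseteq> ?D" by blast
  then have "finite ?U" using finite_reg_rels_with[OF assms(1)] by (rule finite_subset)
  moreover have "contracting_rels V d I F \<epsilon> k \<subseteq> ?U"
    using assms by (intro contracting_rels_subset) auto
  ultimately have "real (card (contracting_rels V d I F \<epsilon> k)) \<le> real (card ?U)"
    by (intro of_nat_mono card_mono)
  also have "\<dots> \<le> real (card V choose k) * (real (card V choose m) * (real ((m * k) choose (2 * m)) * ?b))"
  proof (rule card_UN_le_mult)
    have "card {S. S \<subseteq> V - I \<and> card S = k} = card (V - I) choose k"
      using assms(1) by (intro n_subsets) auto
    also have "\<dots> \<le> card V choose k"
      using assms(1) by (intro binomial_right_mono card_mono) auto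
    finally show "card {S. S \<subseteq> V - I \<and> card S = k} \<le> card V choose k" .
  next
    fix S assume "S \<in> {S. S \<subseteq> V - I \<and> card S = k}"
    then have S: "S \<subseteq> V - I" "card S = k" "finite S"
      using assms(1) finite_subset[of S V] by auto
    show "real (card (\<Union>T\<in>{T. T \<subseteq> V \<and> card T = m}. \<Union>A\<in>{A. A \<subseteq> T \<times> S \<and> card A = 2 * m}.
        {E \<in> ?D. A \<subseteq> E})) \<le> real (card V choose m) * (real ((m * k) choose (2 * m)) * ?b)"
    proof (rule card_UN_le_mult)
      show "card {T. T \<subseteq> V \<and> card T = m} \<le> card V choose m"
        using n_subsets[OF assms(1)] by simp
    next
      fix T assume "T \<in> {T. T \<subseteq> V \<and> card T = m}"
      then have T: "T \<subseteq> V" "card T = m" "finite T"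
        using assms(1) finite_subset[of T V] by auto
      have fin: "finite (T \<times> S)" using T S by simp
      show "real (card (\<Union>A\<in>{A. A \<subseteq> T \<times> S \<and> card A = 2 * m}. {E \<in> ?D. A \<subseteq> E}))
        \<le> real ((m * k) choose (2 * m)) * ?b"
      proof (rule card_UN_le_mult)
        show "card {A. A \<subseteq> T \<times> S \<and> card A = 2 * m} \<le> (m * k) choose (2 * m)"
          using n_subsets[OF fin] S T by (simp add: card_cartesian_product)
      next
        fix A assume "A \<in> {A. A \<subseteq> T \<times> S \<and> card A = 2 * m}"
        then have A: "A \<subseteq> T \<times> S" "card A = 2 * m" "finite A"
          using finite_subset[OF _ fin] by auto
        \<comment> \<open>The edges of \<open>A\<close> end outside \<open>I\<close>, and
          \<open>32 * m \<le> card V\<close> is the size condition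
          \<open>16 * card A \<le> card V\<close>, so \<open>card_supersets_le\<close>
          applies.\<close>
        have "A \<subseteq> V \<times> (V - I)" using A(1) T(1) S(1) by blast
        then show "real (card {E \<in> ?D. A \<subseteq> E}) \<le> ?b"
          using card_supersets_le[OF assms(1,2) A(3) _ assms(3,4) _ assms(5)] A(2) assms(6) by simp
      qed (use fin in auto)
    qed (use assms(1) in auto)
  qed (use assms(1) in auto)
  finally show ?thesis .
qed

section \<open>Regular digraphs as edge relations\<close>

lemma pair_digraph_arcs_subset:
  "pair_wf_digraph G \<longleftrightarrow> parcs G \<subseteq> pverts G \<times> pverts G"
  by (auto simp: pair_wf_digraph_def)

lemma in_nbrs_eq: "pair_wf_digraph G \<Longrightarrow> in_nbrs G S = fst ` {e \<in> parcs G. snd e \<in> S}"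
  by (force simp: in_nbrs_def pair_digraph_arcs_subset)

lemma nbrs_singleton:
  assumes "pair_wf_digraph G"
  shows "in_nbrs G {v} = (parcs G)\<inverse> `` {v}" "out_nbrs G {v} = parcs G `` {v}"
  using assms by (auto simp: in_nbrs_def out_nbrs_def pair_digraph_arcs_subset)

text \<open>All these digraphs share the vertex set \<open>{1..n}\<close>, so counts of digraphs
  become counts of edge sets.\<close>

lemma inj_on_parcs: "inj_on parcs (reg_digraphs n d)"
  by (rule inj_onI) (simp add: reg_digraphs_def)

lemma parcs_reg_digraphs: "parcs ` reg_digraphs n d = reg_rels {1..n} d"
proof
  show "parcs ` reg_digraphs n d \<subseteq> reg_rels {1..n} d"
    by (auto simp: reg_digraphs_def reg_rels_def nbrs_singleton)
       (auto simp: pair_digraph_arcs_subset)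
next
  show "reg_rels {1..n} d \<subseteq> parcs ` reg_digraphs n d"
  proof
    fix E assume E: "E \<in> reg_rels {1..n} d"
    let ?G = "\<lparr>pverts = {1..n}, parcs = E\<rparr>"
    have "pair_wf_digraph ?G" using E by (auto simp: pair_digraph_arcs_subset reg_rels_def)
    then have "?G \<in> reg_digraphs n d"
      using E by (simp add: reg_digraphs_def nbrs_singleton reg_rels_def)
    then show "E \<in> parcs ` reg_digraphs n d" by (rule rev_image_eqI) simp
  qed
qed

lemma finite_reg_digraphs: "finite (reg_digraphs n d)"
  by (rule finite_imageD[OF _ inj_on_parcs]) (simp add: parcs_reg_digraphs finite_reg_rels)

lemma image_Collect_comp: "f ` {x \<in> A. P (f x)} = {y \<in> f ` A. P y}"
  by auto

lemma parcs_reg_digraphs_with: "parcs ` reg_digraphs_with n d I F = reg_rels_with {1..n} d I F"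
  unfolding reg_digraphs_with_def reg_rels_with_def parcs_reg_digraphs[symmetric]
  by (rule image_Collect_comp)

lemma card_reg_digraphs_with:
  "card (reg_digraphs_with n d I F) = card (reg_rels_with {1..n} d I F)"
  unfolding parcs_reg_digraphs_with[symmetric]
  by (rule card_image[symmetric], rule inj_on_subset[OF inj_on_parcs])
     (auto simp: reg_digraphs_with_def)

lemma card_Gamma_k:
  "card (Gamma_k n d \<epsilon> I k \<inter> reg_digraphs_with n d I F)
    = card (contracting_rels {1..n} d I F \<epsilon> k)"
proof -
  have wf: "pair_wf_digraph G" if "G \<in> reg_digraphs n d" for G
    using that by (simp add: reg_digraphs_def)
  \<comment> \<open>The condition is rewritten so that it depends on \<open>parcs G\<close> only,
    which lets \<open>image_Collect_comp\<close> carry it over.\<close>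
  have eq: "Gamma_k n d \<epsilon> I k \<inter> reg_digraphs_with n d I F = {G \<in> reg_digraphs_with n d I F.
      \<exists>S \<subseteq> {1..n} - I. card S = k \<and>
        real (card (fst ` {e \<in> parcs G. snd e \<in> S})) \<le> (1 - \<epsilon>) * real d * real k}"
    unfolding Gamma_k_def reg_digraphs_with_def
    using wf by (auto simp add: in_nbrs_eq cong: conj_cong)
  have "parcs ` (Gamma_k n d \<epsilon> I k \<inter> reg_digraphs_with n d I F)
      = contracting_rels {1..n} d I F \<epsilon> k"
    unfolding eq contracting_rels_def parcs_reg_digraphs_with[symmetric]
    by (rule image_Collect_comp)
  moreover have "inj_on parcs (Gamma_k n d \<epsilon> I k \<inter> reg_digraphs_with n d I F)"
    by (rule inj_on_subset[OF inj_on_parcs]) (auto simp: reg_digraphs_with_def)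
  ultimately show ?thesis using card_image by metis
qed

section \<open>Conditional probabilities\<close>

lemma cond_prob_reg_eq:
  assumes "B \<subseteq> reg_digraphs n d"
  shows "cond_prob_reg n d A B = real (card (A \<inter> B)) / real (card B)"
proof -
  have "{G \<in> reg_digraphs n d. G \<in> A \<and> G \<in> B} = A \<inter> B" "{G \<in> reg_digraphs n d. G \<in> B} = B"
    using assms by auto
  moreover have "A \<inter> B \<subseteq> reg_digraphs n d" using assms by auto
  ultimately have "cond_prob_reg n d A B = real (card (A \<inter> B)) / real (card (reg_digraphs n d))
      / (real (card B) / real (card (reg_digraphs n d)))"
    using assms finite_reg_digraphs
    by (simp add: cond_prob_reg_def cond_prob_def space_uniform_count_measure
        measure_uniform_count_measure)
  \<comment> \<open>If there is no regular digraph, both sides are \<open>0\<close> by division by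
    zero; otherwise the normalization cancels.\<close>
  moreover have "B = {}" if "card (reg_digraphs n d) = 0"
    using that assms finite_reg_digraphs by auto
  ultimately show ?thesis by auto
qed

text \<open>The count over \<open>S\<close>, \<open>T\<close> and \<open>A\<close> is combined with
  \<open>union_bound_estimate\<close>, with \<open>m\<close> the integer part of half the number
  \<open>\<epsilon> * d * k\<close> of coincidences.\<close>

lemma cond_prob_Gamma_k_le:
  fixes \<epsilon> :: real and n d k :: nat
  assumes \<epsilon>: "0 < \<epsilon>" "\<epsilon> < 1" and d: "8 \<le> d" and k: "2 \<le> k"
    and \<epsilon>8: "8 \<le> \<epsilon>\<^sup>2 * real d" and \<epsilon>ln: "ln (real d) \<le> \<epsilon>\<^sup>2 * real d"
    and kn: "real k \<le> exp (- 26) * \<epsilon> * real n / real d"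
    and I: "I \<subseteq> {1..n}" "real (card I) \<le> real n / 8"
    and ne: "reg_digraphs_with n d I F \<noteq> {}"
  shows "cond_prob_reg n d (Gamma_k n d \<epsilon> I k) (reg_digraphs_with n d I F)
    \<le> exp (- (\<epsilon> * real d * real k) * (1 + ln (\<epsilon> * real n / (real d * real k)) / 8))"
proof -
  let ?D = "reg_rels_with {1..n} d I F"
  define m where "m = nat \<lfloor>\<epsilon> * real d * real k / 2\<rfloor>"
  have "0 \<le> \<epsilon> * real d * real k / 2" using \<epsilon> by simp
  then have m: "real m \<le> \<epsilon> * real d * real k / 2" "\<epsilon> * real d * real k / 2 - 1 \<le> real m"
    unfolding m_def by linarith+
  \<comment> \<open>This crude bound gives \<open>d * k \<le> n / 32\<close>, from which the size
    conditions \<open>16 * d \<le> n\<close> and \<open>32 * m \<le> n\<close> follow.\<close>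
  have c: "exp (- 26) \<le> (1 / 32 :: real)"
    using exp_lower_Taylor_quadratic[of "26::real"] by (simp add: exp_minus field_simps power2_eq_square)
  have dk: "real d * real k \<le> exp (- 26) * \<epsilon> * real n"
    using kn d by (simp add: field_simps)
  have "exp (- 26) * \<epsilon> * real n \<le> 1 / 32 * 1 * real n"
    using c \<epsilon> by (intro mult_mono) auto
  then have dk32: "real d * real k \<le> real n / 32" using dk by simp
  have "real d * 2 \<le> real d * real k" using k by (intro mult_left_mono) auto
  then have d16: "16 * d \<le> n" using dk32 by linarith
  have "\<epsilon> * (real d * real k) \<le> 1 * (real d * real k)"
    using \<epsilon> by (intro mult_right_mono) auto
  then have m32: "32 * m \<le> n" using dk32 m by (simp add: mult.assoc)
  \<comment> \<open>The assumed bound on \<open>k\<close>, read as a lower bound on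
    \<open>x\<close>.\<close>
  have x: "exp 26 \<le> \<epsilon> * real n / (real d * real k)"
    using dk d k by (simp add: exp_minus field_simps)
  let ?q = "real (n choose k) * real (n choose m) * real ((m * k) choose (2 * m))
      * (2 * real d / real n) ^ (2 * m)"
  have "real (card (contracting_rels {1..n} d I F \<epsilon> k)) \<le> ?q * real (card ?D)"
    using card_contracting_rels_le[of "{1..n}" I d m \<epsilon> k F] I d d16 m32 m \<epsilon>
    by (simp add: mult.assoc)
  moreover have "card ?D > 0"
    using ne parcs_reg_digraphs_with[of n d I F] finite_reg_rels_with[of "{1..n}" d I F]
    by (auto simp: card_gt_0_iff)
  ultimately have "real (card (contracting_rels {1..n} d I F \<epsilon> k)) / real (card ?D) \<le> ?q"
    by (simp add: divide_le_eq)
  also have "?q \<le> exp (- (\<epsilon> * real d * real k) * (1 + ln (\<epsilon> * real n / (real d * real k)) / 8))"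
    using union_bound_estimate[OF \<epsilon> d k \<epsilon>8 \<epsilon>ln x m(2)] .
  finally show ?thesis
    by (subst cond_prob_reg_eq) (auto simp: reg_digraphs_with_def card_Gamma_k[unfolded reg_digraphs_with_def] card_reg_digraphs_with[unfolded reg_digraphs_with_def])
qed

lemma le_exp_minus_mult_iff: "a \<le> exp (- b) * c \<longleftrightarrow> exp b * a \<le> c" for a b c :: real
  using pos_le_divide_eq[of "exp b" a c] by (simp add: exp_minus divide_inverse mult.commute)

text \<open>The sizes start at \<open>2\<close> because a single vertex has exactly \<open>d\<close>
  in-neighbours, more than \<open>(1 - \<epsilon>) * d\<close>.\<close>

lemma Gamma_le_eq:
  assumes "0 < \<epsilon>" "1 \<le> d"
  shows "Gamma_le c n d \<epsilon> I =
    (\<Union>l \<in> {l. 2 \<le> l \<and> real l \<le> c * \<epsilon> * real n / real d}. Gamma_k n d \<epsilon> I l)"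
proof
  show "Gamma_le c n d \<epsilon> I \<subseteq>
    (\<Union>l \<in> {l. 2 \<le> l \<and> real l \<le> c * \<epsilon> * real n / real d}. Gamma_k n d \<epsilon> I l)"
  proof
    fix G assume "G \<in> Gamma_le c n d \<epsilon> I"
    then obtain S where G: "G \<in> reg_digraphs n d" and S: "S \<subseteq> {1..n} - I" "S \<noteq> {}"
      and le: "real (card S) \<le> c * \<epsilon> * real n / real d"
      and contr: "real (card (in_nbrs G S)) \<le> (1 - \<epsilon>) * real d * real (card S)"
      by (auto simp: Gamma_le_def)
    have fin: "finite S" using S(1) finite_subset by blast
    have "card S \<noteq> 1"
    proof
      assume "card S = 1"
      then obtain v where v: "S = {v}" by (auto simp: card_1_singleton_iff)
      then have "card (in_nbrs G S) = d" using G S(1) by (auto simp: reg_digraphs_def)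
      then have "\<epsilon> * real d \<le> 0" using contr v by (simp add: algebra_simps)
      then show False using assms by (simp add: mult_le_0_iff)
    qed
    moreover have "card S \<noteq> 0" using S(2) fin by simp
    ultimately have "2 \<le> card S" by linarith
    moreover have "G \<in> Gamma_k n d \<epsilon> I (card S)"
      unfolding Gamma_k_def using G S(1) contr by blast
    ultimately show "G \<in> (\<Union>l \<in> {l. 2 \<le> l \<and> real l \<le> c * \<epsilon> * real n / real d}. Gamma_k n d \<epsilon> I l)"
      using le by blast
  qed
next
  have "Gamma_k n d \<epsilon> I l \<subseteq> Gamma_le c n d \<epsilon> I"
    if l: "2 \<le> l" "real l \<le> c * \<epsilon> * real n / real d" for l
  proof
    fix G assume "G \<in> Gamma_k n d \<epsilon> I l"
    then obtain S where G: "G \<in> reg_digraphs n d" and S: "S \<subseteq> {1..n} - I" "card S = l"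
      and contr: "real (card (in_nbrs G S)) \<le> (1 - \<epsilon>) * real d * real (card S)"
      unfolding Gamma_k_def by blast
    have "S \<noteq> {}" using S(2) l(1) by auto
    moreover have "real (card S) \<le> c * \<epsilon> * real n / real d" using S(2) l(2) by simp
    ultimately show "G \<in> Gamma_le c n d \<epsilon> I"
      unfolding Gamma_le_def using G S(1) contr by blast
  qed
  then show "(\<Union>l \<in> {l. 2 \<le> l \<and> real l \<le> c * \<epsilon> * real n / real d}. Gamma_k n d \<epsilon> I l)
    \<subseteq> Gamma_le c n d \<epsilon> I" by blast
qed

text \<open>The summand \<open>1\<close> in the exponent for size \<open>l\<close> supplies a factor
  \<open>exp (- l)\<close>, so the sum over \<open>l\<close> costs nothing; the logarithmic part is
  bounded by its value at \<open>l = 1\<close>.\<close>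

lemma cond_prob_Gamma_le_le:
  fixes \<epsilon> :: real and n d :: nat
  assumes \<epsilon>: "0 < \<epsilon>" "\<epsilon> < 1" and d: "8 \<le> d"
    and \<epsilon>8: "8 \<le> \<epsilon>\<^sup>2 * real d" and \<epsilon>ln: "ln (real d) \<le> \<epsilon>\<^sup>2 * real d"
    and I: "I \<subseteq> {1..n}" "real (card I) \<le> real n / 8"
    and ne: "reg_digraphs_with n d I F \<noteq> {}"
  shows "cond_prob_reg n d (Gamma_le (exp (- 26)) n d \<epsilon> I) (reg_digraphs_with n d I F)
    \<le> exp (- (\<epsilon> * real d / 8 * ln (\<epsilon> * real n / real d)))"
proof -
  let ?D = "reg_digraphs_with n d I F"
  let ?b = "exp (- (\<epsilon> * real d / 8 * ln (\<epsilon> * real n / real d)))"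
  define N where "N = nat \<lfloor>exp (- 26) * \<epsilon> * real n / real d\<rfloor>"
  have sub: "?D \<subseteq> reg_digraphs n d" by (auto simp: reg_digraphs_with_def)
  have D0: "real (card ?D) > 0"
    using ne finite_subset[OF sub finite_reg_digraphs] by (simp add: card_gt_0_iff)
  have "0 \<le> exp (- 26) * \<epsilon> * real n / real d" using \<epsilon> by simp
  then have "{l. 2 \<le> l \<and> real l \<le> exp (- 26) * \<epsilon> * real n / real d} = {2..N}"
    unfolding N_def by (auto simp: le_nat_iff le_floor_iff)
  then have eq: "Gamma_le (exp (- 26)) n d \<epsilon> I = (\<Union>l\<in>{2..N}. Gamma_k n d \<epsilon> I l)"
    using Gamma_le_eq[of \<epsilon> d] \<epsilon> d by simp
  have "real (card (Gamma_le (exp (- 26)) n d \<epsilon> I \<inter> ?D))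
      \<le> real (\<Sum>l=2..N. card (Gamma_k n d \<epsilon> I l \<inter> ?D))"
    unfolding eq Int_UN_distrib2[symmetric] UN_extend_simps by (intro of_nat_mono card_UN_le) simp
  then have "cond_prob_reg n d (Gamma_le (exp (- 26)) n d \<epsilon> I) ?D
      \<le> (\<Sum>l=2..N. cond_prob_reg n d (Gamma_k n d \<epsilon> I l) ?D)"
    using D0 by (simp add: cond_prob_reg_eq[OF sub] divide_right_mono flip: sum_divide_distrib)
  also have "\<dots> \<le> (\<Sum>l=2..N. exp (- real l) * ?b)"
  proof (rule sum_mono)
    fix l assume l: "l \<in> {2..N}"
    then have l2: "2 \<le> l" by simp
    have "real l \<le> real N" using l by simp
    also have "\<dots> \<le> exp (- 26) * \<epsilon> * real n / real d" unfolding N_def using \<epsilon> by simp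
    finally have ln: "real l \<le> exp (- 26) * \<epsilon> * real n / real d" .
    have "\<epsilon>\<^sup>2 * real d \<le> \<epsilon> * real d"
      using \<epsilon> by (intro mult_right_mono) (auto simp: power2_eq_square)
    then have \<epsilon>d: "1 \<le> \<epsilon> * real d" using \<epsilon>8 by linarith
    \<comment> \<open>The premise of \<open>mult_ln_div_ge\<close>, applied with
      \<open>a = \<epsilon> * n / d\<close>.\<close>
    have "exp 1 * real l \<le> exp 26 * real l" by (intro mult_right_mono) auto
    also have "\<dots> \<le> \<epsilon> * real n / real d" using ln le_exp_minus_mult_iff[of "real l" 26 "\<epsilon> * real n / real d"] by simp
    finally have "ln (\<epsilon> * real n / real d) \<le> real l * ln (\<epsilon> * real n / real d / real l)"
      using l2 by (intro mult_ln_div_ge) auto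
    then have "\<epsilon> * real d * ln (\<epsilon> * real n / real d)
        \<le> \<epsilon> * real d * (real l * ln (\<epsilon> * real n / real d / real l))"
      using \<epsilon>d by (intro mult_left_mono) auto
    moreover have "real l \<le> \<epsilon> * real d * real l"
      using \<epsilon>d mult_right_mono[of 1 "\<epsilon> * real d" "real l"] by simp
    ultimately have le: "- (\<epsilon> * real d * real l) * (1 + ln (\<epsilon> * real n / (real d * real l)) / 8)
        \<le> - real l + - (\<epsilon> * real d / 8 * ln (\<epsilon> * real n / real d))"
      by (simp add: algebra_simps)
    show "cond_prob_reg n d (Gamma_k n d \<epsilon> I l) ?D \<le> exp (- real l) * ?b"
      unfolding exp_add[symmetric]
      by (rule order_trans[OF cond_prob_Gamma_k_le[OF \<epsilon> d l2 \<epsilon>8 \<epsilon>ln ln I ne]])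
         (simp only: exp_le_cancel_iff le)
  qed
  also have "\<dots> = (\<Sum>l=2..N. exp (- real l)) * ?b" by (simp add: sum_distrib_right)
  also have "\<dots> \<le> 1 * ?b" by (intro mult_right_mono sum_exp_neg_le_1) auto
  finally show ?thesis by simp
qed

theorem theorem2p2:
  shows "\<exists>c::real. c > 0 \<and> ( \<forall>(n::nat) (d::nat) (\<epsilon>::real) (k::nat) (I::nat set).
    8 \<le> d \<longrightarrow> d \<le> n \<longrightarrow> 0 < \<epsilon> \<longrightarrow> \<epsilon> < 1 \<longrightarrow> 2 \<le> k \<longrightarrow>
    \<epsilon>\<^sup>2 \<ge> max 8 (ln (real d)) / real d \<longrightarrow>
    real k \<le> c * \<epsilon> * real n / real d \<longrightarrow>
    I \<subseteq> {1..n} \<longrightarrow> real (card I) \<le> real n / 8 \<longrightarrow>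
      Gamma_le c n d \<epsilon> I =
        (\<Union>l \<in> {l. 2 \<le> l \<and> real l \<le> c * \<epsilon> * real n / real d}. Gamma_k n d \<epsilon> I l) \<and>
      (\<forall>F. F \<subseteq> {1..n} \<times> {1..n} \<longrightarrow> reg_digraphs_with n d I F \<noteq> {} \<longrightarrow>
        cond_prob_reg n d (Gamma_k n d \<epsilon> I k) (reg_digraphs_with n d I F)
          \<le> exp (- (\<epsilon>\<^sup>2 * real d * real k / 8
                    * ln (3 * exp 1 * c * \<epsilon> * real n / (real k * real d)))) \<and>
        cond_prob_reg n d (Gamma_le c n d \<epsilon> I) (reg_digraphs_with n d I F)
          \<le> exp (- (\<epsilon>\<^sup>2 * real d / 8 * ln (exp 1 * c * \<epsilon> * real n / real d)))))"
proof (intro exI[of _ "exp (- 26) :: real"] conjI allI impI)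
  show "exp (- 26) > (0::real)" by simp
next
  fix n d k :: nat and \<epsilon> :: real and I :: "nat set"
  assume d: "8 \<le> d" and \<epsilon>: "0 < \<epsilon>"
  then show "Gamma_le (exp (- 26)) n d \<epsilon> I =
      (\<Union>l \<in> {l. 2 \<le> l \<and> real l \<le> exp (- 26) * \<epsilon> * real n / real d}. Gamma_k n d \<epsilon> I l)"
    by (intro Gamma_le_eq) auto
next
  fix n d k :: nat and \<epsilon> :: real and I :: "nat set" and F :: "(nat \<times> nat) set"
  assume d: "8 \<le> d" and \<epsilon>: "0 < \<epsilon>" "\<epsilon> < 1" and k: "2 \<le> k"
    and \<epsilon>2: "\<epsilon>\<^sup>2 \<ge> max 8 (ln (real d)) / real d"
    and kn: "real k \<le> exp (- 26) * \<epsilon> * real n / real d"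
    and I: "I \<subseteq> {1..n}" "real (card I) \<le> real n / 8"
    and ne: "reg_digraphs_with n d I F \<noteq> {}"
  have "max 8 (ln (real d)) \<le> \<epsilon>\<^sup>2 * real d" using \<epsilon>2 d by (simp add: divide_le_eq)
  then have \<epsilon>8: "8 \<le> \<epsilon>\<^sup>2 * real d" and \<epsilon>ln: "ln (real d) \<le> \<epsilon>\<^sup>2 * real d" by auto
  have \<epsilon>sq: "\<epsilon>\<^sup>2 \<le> \<epsilon>" using \<epsilon> by (simp add: power2_eq_square)
  \<comment> \<open>The bounds proved so far have \<open>\<epsilon>\<close> in front and no constant
    inside the logarithm. Passing to \<open>\<epsilon>\<^sup>2\<close> is sound because
    \<open>1 \<le> y\<close> makes \<open>ln y\<close> nonnegative.\<close>
  have weaken: "exp (- (\<epsilon> * p * ln y)) \<le> exp (- (\<epsilon>\<^sup>2 * p * ln z))"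
    if "0 \<le> p" "1 \<le> y" "0 < z" "z \<le> y" for p y z :: real
  proof -
    have "\<epsilon>\<^sup>2 * p * ln z \<le> \<epsilon>\<^sup>2 * p * ln y" using that by (intro mult_left_mono) auto
    also have "\<dots> \<le> \<epsilon> * p * ln y" using that \<epsilon>sq by (intro mult_right_mono) auto
    finally show ?thesis by simp
  qed
  have d0: "real d > 0" and k0: "real k > 0" using d k by auto
  have x: "exp 26 * real k \<le> \<epsilon> * real n / real d"
    using kn le_exp_minus_mult_iff[of "real k" 26 "\<epsilon> * real n / real d"] by simp
  moreover have "1 * real k \<le> exp 26 * real k" by (intro mult_right_mono) auto
  ultimately have xk: "real k \<le> \<epsilon> * real n / real d" by simp
  then have n0: "real n > 0" using k0 by (cases "n = 0") auto
  \<comment> \<open>With \<open>c = exp (- 26)\<close>, this is the constant inside the first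
    claimed logarithm; being at most \<open>1\<close>, it only lowers the argument.\<close>
  have c3: "3 * exp 1 * exp (- 26) \<le> (1::real)"
  proof -
    have "3 * exp 1 * exp (- 26) = 3 / exp (25::real)"
      by (simp add: exp_minus field_simps flip: exp_add)
    also have "\<dots> \<le> 1" using exp_ge_add_one_self[of "25::real"] by simp
    finally show ?thesis .
  qed
  have c1: "exp 1 * exp (- 26) \<le> (1::real)" by (simp flip: exp_add)
  let ?P = "\<lambda>A. cond_prob_reg n d A (reg_digraphs_with n d I F)"
  have "?P (Gamma_k n d \<epsilon> I k)
      \<le> exp (- (\<epsilon> * real d * real k) * (1 + ln (\<epsilon> * real n / (real d * real k)) / 8))"
    using cond_prob_Gamma_k_le[OF \<epsilon> d k \<epsilon>8 \<epsilon>ln kn I ne] .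
  \<comment> \<open>The summand \<open>1\<close> in the exponent, which served the sum over all
    sizes, is dropped.\<close>
  also have "\<dots> \<le> exp (- (\<epsilon> * (real d * real k / 8) * ln (\<epsilon> * real n / (real d * real k))))"
    using \<epsilon> by (simp add: algebra_simps)
  also have "\<dots> \<le> exp (- (\<epsilon>\<^sup>2 * (real d * real k / 8)
      * ln (3 * exp 1 * exp (- 26) * (\<epsilon> * real n / (real d * real k)))))"
  proof (rule weaken)
    show "1 \<le> \<epsilon> * real n / (real d * real k)"
      using xk d0 k0 by (simp add: field_simps)
    show "3 * exp 1 * exp (- 26) * (\<epsilon> * real n / (real d * real k)) \<le> \<epsilon> * real n / (real d * real k)"
      using mult_right_mono[OF c3, of "\<epsilon> * real n / (real d * real k)"] \<epsilon> by simp
  qed (use \<epsilon> n0 d0 k0 in auto)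
  finally show "?P (Gamma_k n d \<epsilon> I k)
      \<le> exp (- (\<epsilon>\<^sup>2 * real d * real k / 8
            * ln (3 * exp 1 * exp (- 26) * \<epsilon> * real n / (real k * real d))))"
    by (simp add: mult_ac)
  have "?P (Gamma_le (exp (- 26)) n d \<epsilon> I) \<le> exp (- (\<epsilon> * (real d / 8) * ln (\<epsilon> * real n / real d)))"
    using cond_prob_Gamma_le_le[OF \<epsilon> d \<epsilon>8 \<epsilon>ln I ne] by simp
  also have "\<dots> \<le> exp (- (\<epsilon>\<^sup>2 * (real d / 8) * ln (exp 1 * exp (- 26) * (\<epsilon> * real n / real d))))"
  proof (rule weaken)
    show "1 \<le> \<epsilon> * real n / real d" using xk k by linarith
    show "exp 1 * exp (- 26) * (\<epsilon> * real n / real d) \<le> \<epsilon> * real n / real d"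
      using mult_right_mono[OF c1, of "\<epsilon> * real n / real d"] \<epsilon> by simp
  qed (use \<epsilon> n0 d0 in auto)
  finally show "?P (Gamma_le (exp (- 26)) n d \<epsilon> I)
      \<le> exp (- (\<epsilon>\<^sup>2 * real d / 8 * ln (exp 1 * exp (- 26) * \<epsilon> * real n / real d)))"
    by (simp add: mult.assoc)
qed

end
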